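(* Assume the Markovian cocycle $\Phi:\mathbb{R}^+\times\Omega\times\mathbb{X}\to\mathbb{X}$ has an adapted random periodic path $Y:\mathbb{R}\times\Omega\to\mathbb{X}$ of period $\tau$. Then the measure function $\rho:\mathbb{R}\to\mathcal P(\mathbb{X})$ defined by $$\rho_s:=E(\mu_s)_\cdot=E\delta_{Y(s,\theta(-s)\cdot)}=E\delta_{Y(s,\cdot)},$$ which is the law of the random periodic path $Y$, is a periodic measure of $\Phi$ on $(\mathbb{X},\mathcal B(\mathbb{X}))$. Its time average over exactly one period $$\bar\rho=\frac1\tau\int_0^\tau\rho_s\,ds$$ is an invariant measure and satisfies, for any $B\in\mathcal B(\mathbb{X})$ and $t\in\mathbb{R}$, $$\bar\rho(B)=E\Big(\frac1\tau\,m\{s\in[0,\tau):Y(s,\cdot)\in B\}\Big)=E\Big(\frac1\tau\,m\{s\in[t,t+\tau):Y(s,\cdot)\in B\}\Big),$$ where $m$ is Lebesgue measure.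
   Context: $\mathbb{X}$ is a Polish space with Borel $\sigma$-algebra $\mathcal B(\mathbb{X})$; $\mathcal P(\mathbb{X})$ is the set of probability measures on it; $\mathbb{R}^+=[0,\infty)$. $(\Omega,\mathcal F,P,(\theta(t))_{t\in\mathbb{R}},(\mathcal F_s^t)_{s\le t})$ is a filtered metric dynamical system: $\theta(t)$ is $P$-preserving and measurably invertible with $\theta(-t)=\theta(t)^{-1}$, and $\theta(u)^{-1}\mathcal F_s^t=\mathcal F_{s+u}^{t+u}$. A cocycle is a jointly measurable $\Phi:\mathbb{R}^+\times\Omega\times\mathbb{X}\to\mathbb{X}$ with $\Phi(0,\omega)=\mathrm{id}$ and $\Phi(t+s,\omega)=\Phi(t,\theta(s)\omega)\Phi(s,\omega)$ for all $s,t\in\mathbb{R}^+$, almost all $\omega$. It is Markovian if $\Phi(t,\cdot)$ is $\mathcal F_0^t$-measurable for every $t\in\mathbb{R}^+$, where $\mathcal F_s^t$ is independent of $\mathcal F_{-\infty}^s:=\bigvee_{r\le s}\mathcal F_r^s$ for $s\le t$ (so that $\Phi(t,\theta(s)\cdot)$ is independent of $\mathcal F_{-\infty}^s$). A random periodic path of period $\tau$ is an $\mathcal F$-measurable map $Y:\mathbb{R}\times\Omega\to\mathbb{X}$ such that for almost all $\omega$: $\Phi(t,\theta(s)\omega)Y(s,\omega)=Y(t+s,\omega)$, $Y(s+\tau,\omega)=Y(s,\theta(\tau)\omega)$ for all $t\in\mathbb{R}^+$, $s\in\mathbb{R}$. It is adapted if $Y(s,\cdot)$ is $\mathcal F_{-\infty}^s$-measurable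 for each $s$. Here $(\mu_s)_\omega=\delta_{Y(s,\theta(-s)\omega)}$, and $E$ is expectation with respect to $P$. Transition probability: $P(t,x,B)=P(\{\omega:\Phi(t,\omega)x\in B\})$; $(P^*(t)\rho)(B)=\int_{\mathbb{X}}P(t,x,B)\rho(dx)$. A map $\rho:\mathbb{R}\to\mathcal P(\mathbb{X})$ is a periodic measure of period $\tau$ for $\Phi$ if $\rho_{s+\tau}=\rho_s$ and $\rho_{t+s}=P^*(t)\rho_s$ for all $s\in\mathbb{R}$, $t\in\mathbb{R}^+$. A probability measure $\rho_0$ is invariant if $P^*(t)\rho_0=\rho_0$ for all $t\in\mathbb{R}^+$. *)

theory Defs
  imports "HOL-Probability.Probability"
begin

text \<open>
  A sigma-algebra on \<open>\<Omega>\<close> is represented by a measure \<open>F s t\<close> of which only space and sets matter.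
  The flow laws with \<open>\<theta> 0 = id\<close> give \<open>\<theta> (- t) = (\<theta> t)\<^sup>-\<^sup>1\<close>.
\<close>

locale filtered_metric_dynamical_system = prob_space M
  for M :: "'w measure" and \<theta> :: "real \<Rightarrow> 'w \<Rightarrow> 'w" and F :: "real \<Rightarrow> real \<Rightarrow> 'w measure" +
  assumes shift_measurable: "\<And>t. \<theta> t \<in> M \<rightarrow>\<^sub>M M"
    and shift_preserving: "\<And>t. distr M M (\<theta> t) = M"
    and shift_0: "\<And>\<omega>. \<omega> \<in> space M \<Longrightarrow> \<theta> 0 \<omega> = \<omega>"
    and shift_add: "\<And>s t \<omega>. \<omega> \<in> space M \<Longrightarrow> \<theta> (t + s) \<omega> = \<theta> t (\<theta> s \<omega>)"
    and filtration_subalgebra: "\<And>s t. s \<le> t \<Longrightarrow> subalgebra M (F s t)"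
    and filtration_mono: "\<And>r s t u. r \<le> s \<Longrightarrow> s \<le> t \<Longrightarrow> t \<le> u \<Longrightarrow> sets (F s t) \<subseteq> sets (F r u)"
    and filtration_shift: "\<And>s t u. s \<le> t \<Longrightarrow>
      {\<theta> u -` A \<inter> space M | A. A \<in> sets (F s t)} = sets (F (s + u) (t + u))"

definition past :: "'w measure \<Rightarrow> (real \<Rightarrow> real \<Rightarrow> 'w measure) \<Rightarrow> real \<Rightarrow> 'w measure" where
  "past M F s = sigma (space M) (\<Union>r\<in>{..s}. sets (F r s))"

text \<open>
  Time is of type \<open>real\<close>; values of \<open>\<Phi>\<close> at negative times are never referred to. The exceptional
  null set in the cocycle property may depend on the times.
\<close>

definition cocycle ::
  "'w measure \<Rightarrow> (real \<Rightarrow> 'w \<Rightarrow> 'w) \<Rightarrow> (real \<Rightarrow> 'w \<Rightarrow> 'x::polish_space \<Rightarrow> 'x) \<Rightarrow> bool" where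
  "cocycle M \<theta> \<Phi> \<longleftrightarrow>
     (\<lambda>(t, \<omega>, x). \<Phi> t \<omega> x) \<in> restrict_space borel {0..} \<Otimes>\<^sub>M M \<Otimes>\<^sub>M borel \<rightarrow>\<^sub>M borel \<and>
     (AE \<omega> in M. \<Phi> 0 \<omega> = id) \<and>
     (\<forall>s\<ge>0. \<forall>t\<ge>0. AE \<omega> in M. \<Phi> (t + s) \<omega> = \<Phi> t (\<theta> s \<omega>) \<circ> \<Phi> s \<omega>)"

text \<open>
  Measurability of \<open>\<Phi> t\<close> with respect to \<open>F 0 t\<close> is meant jointly in \<open>(\<omega>, x)\<close>. Measurability of
  \<open>\<lambda>\<omega>. \<Phi> t \<omega> x\<close> for each fixed \<open>x\<close> would not give \<open>E f (\<Phi> t (\<theta> s \<omega>) (Z \<omega>)) = E P(t, Z, f)\<close> for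
  variables \<open>Z\<close> measurable with respect to the past.
\<close>

definition markovian_cocycle ::
  "'w measure \<Rightarrow> (real \<Rightarrow> 'w \<Rightarrow> 'w) \<Rightarrow> (real \<Rightarrow> real \<Rightarrow> 'w measure) \<Rightarrow>
   (real \<Rightarrow> 'w \<Rightarrow> 'x::polish_space \<Rightarrow> 'x) \<Rightarrow> bool" where
  "markovian_cocycle M \<theta> F \<Phi> \<longleftrightarrow> cocycle M \<theta> \<Phi> \<and>
     (\<forall>t\<ge>0. (\<lambda>(\<omega>, x). \<Phi> t \<omega> x) \<in> F 0 t \<Otimes>\<^sub>M borel \<rightarrow>\<^sub>M borel) \<and>
     (\<forall>s t. s \<le> t \<longrightarrow> prob_space.indep_set M (sets (F s t)) (sets (past M F s)))"

definition random_periodic_path ::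
  "'w measure \<Rightarrow> (real \<Rightarrow> 'w \<Rightarrow> 'w) \<Rightarrow> (real \<Rightarrow> 'w \<Rightarrow> 'x::polish_space \<Rightarrow> 'x) \<Rightarrow>
   real \<Rightarrow> (real \<Rightarrow> 'w \<Rightarrow> 'x) \<Rightarrow> bool" where
  "random_periodic_path M \<theta> \<Phi> \<tau> Y \<longleftrightarrow> \<tau> > 0 \<and>
     (\<lambda>(s, \<omega>). Y s \<omega>) \<in> borel \<Otimes>\<^sub>M M \<rightarrow>\<^sub>M borel \<and>
     (AE \<omega> in M. \<forall>t\<ge>0. \<forall>s. \<Phi> t (\<theta> s \<omega>) (Y s \<omega>) = Y (t + s) \<omega> \<and> Y (s + \<tau>) \<omega> = Y s (\<theta> \<tau> \<omega>))"

definition adapted ::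
  "'w measure \<Rightarrow> (real \<Rightarrow> real \<Rightarrow> 'w measure) \<Rightarrow> (real \<Rightarrow> 'w \<Rightarrow> 'x::polish_space) \<Rightarrow> bool" where
  "adapted M F Y \<longleftrightarrow> (\<forall>s. Y s \<in> past M F s \<rightarrow>\<^sub>M borel)"

definition transition_prob ::
  "'w measure \<Rightarrow> (real \<Rightarrow> 'w \<Rightarrow> 'x::polish_space \<Rightarrow> 'x) \<Rightarrow> real \<Rightarrow> 'x \<Rightarrow> 'x measure" where
  "transition_prob M \<Phi> t x = distr M borel (\<lambda>\<omega>. \<Phi> t \<omega> x)"

text \<open>
  Below, \<open>N \<bind> \<kappa>\<close> is the measure \<open>B \<mapsto> \<integral> \<kappa> i B \<partial>N i\<close> (see \<open>emeasure_bind\<close>).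
\<close>

definition dual_semigroup ::
  "'w measure \<Rightarrow> (real \<Rightarrow> 'w \<Rightarrow> 'x::polish_space \<Rightarrow> 'x) \<Rightarrow> real \<Rightarrow> 'x measure \<Rightarrow> 'x measure" where
  "dual_semigroup M \<Phi> t \<rho> = \<rho> \<bind> transition_prob M \<Phi> t"

definition periodic_measure ::
  "'w measure \<Rightarrow> (real \<Rightarrow> 'w \<Rightarrow> 'x::polish_space \<Rightarrow> 'x) \<Rightarrow> real \<Rightarrow> (real \<Rightarrow> 'x measure) \<Rightarrow> bool" where
  "periodic_measure M \<Phi> \<tau> \<rho> \<longleftrightarrow> (\<forall>s. \<rho> s \<in> space (prob_algebra borel)) \<and>
     (\<forall>s. \<rho> (s + \<tau>) = \<rho> s) \<and>
     (\<forall>s. \<forall>t\<ge>0. \<rho> (t + s) = dual_semigroup M \<Phi> t (\<rho> s))"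

definition invariant_measure ::
  "'w measure \<Rightarrow> (real \<Rightarrow> 'w \<Rightarrow> 'x::polish_space \<Rightarrow> 'x) \<Rightarrow> 'x measure \<Rightarrow> bool" where
  "invariant_measure M \<Phi> \<rho>\<^sub>0 \<longleftrightarrow> \<rho>\<^sub>0 \<in> space (prob_algebra borel) \<and>
     (\<forall>t\<ge>0. dual_semigroup M \<Phi> t \<rho>\<^sub>0 = \<rho>\<^sub>0)"

definition random_dirac ::
  "(real \<Rightarrow> 'w \<Rightarrow> 'w) \<Rightarrow> (real \<Rightarrow> 'w \<Rightarrow> 'x::polish_space) \<Rightarrow> real \<Rightarrow> 'w \<Rightarrow> 'x measure" where
  "random_dirac \<theta> Y s \<omega> = return borel (Y s (\<theta> (- s) \<omega>))"

definition expected_measure :: "'w measure \<Rightarrow> ('w \<Rightarrow> 'x measure) \<Rightarrow> 'x measure" where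
  "expected_measure M \<mu> = M \<bind> \<mu>"

definition time_average :: "real \<Rightarrow> (real \<Rightarrow> 'x measure) \<Rightarrow> 'x measure" where
  "time_average \<tau> \<rho> = uniform_measure lborel {0..<\<tau>} \<bind> \<rho>"

lemma emeasure_transition_prob:
  assumes "cocycle M \<theta> \<Phi>" "t \<ge> 0" "B \<in> sets borel"
  shows "emeasure (transition_prob M \<Phi> t x) B = emeasure M {\<omega> \<in> space M. \<Phi> t \<omega> x \<in> B}"
proof -
  have *: "(\<lambda>(t, \<omega>, x). \<Phi> t \<omega> x) \<in> restrict_space borel {0..} \<Otimes>\<^sub>M M \<Otimes>\<^sub>M borel \<rightarrow>\<^sub>M borel"
    using assms by (simp add: cocycle_def)
  have "(\<lambda>\<omega>. (t, \<omega>, x)) \<in> M \<rightarrow>\<^sub>M restrict_space borel {0..} \<Otimes>\<^sub>M M \<Otimes>\<^sub>M borel"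
    using assms(2) by (simp add: space_restrict_space)
  from measurable_compose[OF this *] have "(\<lambda>\<omega>. \<Phi> t \<omega> x) \<in> M \<rightarrow>\<^sub>M borel"
    by simp
  from emeasure_distr[OF this assms(3)] show ?thesis
    by (simp add: transition_prob_def vimage_def Int_def conj_commute)
qed

lemma emeasure_dual_semigroup:
  assumes "prob_space M" "cocycle M \<theta> \<Phi>" "t \<ge> 0" "\<rho> \<in> space (prob_algebra borel)" "B \<in> sets borel"
  shows "emeasure (dual_semigroup M \<Phi> t \<rho>) B = (\<integral>\<^sup>+x. emeasure (transition_prob M \<Phi> t x) B \<partial>\<rho>)"
proof -
  interpret prob_space M by fact
  have sets: "sets \<rho> = sets borel" and "prob_space \<rho>"
    using assms by (auto simp: space_prob_algebra)
  have *: "(\<lambda>(t, \<omega>, x). \<Phi> t \<omega> x) \<in> restrict_space borel {0..} \<Otimes>\<^sub>M M \<Otimes>\<^sub>M borel \<rightarrow>\<^sub>M borel"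
    using assms by (simp add: cocycle_def)
  have "(\<lambda>p. (t, snd p, fst p)) \<in> borel \<Otimes>\<^sub>M M \<rightarrow>\<^sub>M restrict_space borel {0..} \<Otimes>\<^sub>M M \<Otimes>\<^sub>M borel"
    using assms by (intro measurable_Pair) (auto simp: space_restrict_space)
  from measurable_compose[OF this *]
  have "(\<lambda>(x, \<omega>). \<Phi> t \<omega> x) \<in> borel \<Otimes>\<^sub>M M \<rightarrow>\<^sub>M borel"
    by (simp add: case_prod_beta)
  moreover have "M \<in> space (subprob_algebra M)"
    by (simp add: space_subprob_algebra prob_space_imp_subprob_space prob_space_axioms)
  ultimately have "transition_prob M \<Phi> t \<in> borel \<rightarrow>\<^sub>M subprob_algebra borel"
    unfolding transition_prob_def by (intro measurable_distr2[where M=M] measurable_const) auto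
  then have "transition_prob M \<Phi> t \<in> \<rho> \<rightarrow>\<^sub>M subprob_algebra borel"
    using measurable_cong_sets[OF sets refl] by blast
  then show ?thesis
    unfolding dual_semigroup_def using assms prob_space.not_empty[OF \<open>prob_space \<rho>\<close>]
    by (intro emeasure_bind) auto
qed

lemma emeasure_time_average:
  assumes "\<tau> > 0" "\<rho> \<in> borel \<rightarrow>\<^sub>M prob_algebra borel" "B \<in> sets borel"
  shows "emeasure (time_average \<tau> \<rho>) B =
    (\<integral>\<^sup>+s. emeasure (\<rho> s) B * indicator {0..<\<tau>} s \<partial>lborel) / ennreal \<tau>"
proof -
  have [measurable]: "\<rho> \<in> borel \<rightarrow>\<^sub>M subprob_algebra borel"
    using assms by (intro measurable_prob_algebraD)
  have "(\<lambda>s. emeasure (\<rho> s) B) \<in> borel_measurable lborel"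
    using assms(3) by measurable
  moreover have "emeasure (time_average \<tau> \<rho>) B = (\<integral>\<^sup>+s. emeasure (\<rho> s) B \<partial>uniform_measure lborel {0..<\<tau>})"
    unfolding time_average_def using assms(3) by (intro emeasure_bind) auto
  ultimately show ?thesis
    using assms(1) by (simp add: nn_integral_uniform_measure)
qed

end

theory Submission
  imports Defs
begin

text \<open>
  The increment \<open>\<theta> s\<close>, seen through \<open>F 0 t\<close>, has the same law as the identity and is independent of
  \<open>Y s\<close>, which is measurable with respect to the past. Fubini's theorem applied to
  \<open>Y (t + s) = \<Phi> t (\<theta> s) (Y s)\<close> therefore gives \<open>\<rho> (t + s) = P\<^sup>*(t) \<rho> s\<close>. Invariance of the time
  average holds because the integral of a periodic function over one period does not depend on where
  the period starts; the last two formulas are Fubini's theorem on \<open>[t, t + \<tau>) \<times> \<Omega>\<close>.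
\<close>

section \<open>Integrals of periodic functions over one period\<close>

lemma periodic_int_multiple:
  fixes f :: "real \<Rightarrow> 'a"
  assumes "\<And>x. f (x + \<tau>) = f x"
  shows "f (x + of_int k * \<tau>) = f x"
proof (induction k rule: int_induct[where k=0])
  case (step1 i)
  then show ?case using assms[of "x + of_int i * \<tau>"] by (simp add: algebra_simps)
next
  case (step2 i)
  then show ?case using assms[of "x + of_int (i - 1) * \<tau>"] by (simp add: algebra_simps)
qed simp

text \<open>Translation by a multiple of \<open>\<tau>\<close> moves the starting point into the
  first period. The window \<open>{b..<b + \<tau>}\<close> is then cut at \<open>\<tau>\<close>, and
  its tail, moved back by one period, fills the gap \<open>{0..<b}\<close>.\<close>

lemma nn_integral_periodic:
  fixes f :: "real \<Rightarrow> ennreal"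
  assumes [measurable]: "f \<in> borel_measurable borel" and per: "\<And>x. f (x + \<tau>) = f x" and "\<tau> > 0"
  shows "(\<integral>\<^sup>+x\<in>{a..<a + \<tau>}. f x \<partial>lborel) = (\<integral>\<^sup>+x\<in>{0..<\<tau>}. f x \<partial>lborel)"
proof -
  \<comment> \<open>Translation invariance of Lebesgue measure, as the affine substitution with
    slope 1; periodicity then removes the shift from the argument of \<open>f\<close>.\<close>
  have shift: "(\<integral>\<^sup>+x\<in>{b + of_int k * \<tau>..<c + of_int k * \<tau>}. f x \<partial>lborel) =
      (\<integral>\<^sup>+x\<in>{b..<c}. f x \<partial>lborel)" for b c and k :: int
    by (subst nn_integral_real_affine[where c=1 and t="of_int k * \<tau>"])
       (auto intro!: nn_integral_cong split: split_indicator
             simp: periodic_int_multiple[of f, OF per] add.commute[of "of_int k * \<tau>"])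
  have split: "(\<integral>\<^sup>+x\<in>{b..<d}. f x \<partial>lborel) =
      (\<integral>\<^sup>+x\<in>{b..<c}. f x \<partial>lborel) + (\<integral>\<^sup>+x\<in>{c..<d}. f x \<partial>lborel)" if "b \<le> c" "c \<le> d" for b c d
    using that
    by (subst nn_integral_add[symmetric])
       (auto intro!: nn_integral_cong split: split_indicator)
  \<comment> \<open>\<open>k\<close> is the number of whole periods to remove from \<open>a\<close>,
    so \<open>b\<close> is the residue of \<open>a\<close> modulo \<open>\<tau>\<close>.\<close>
  define k where "k = \<lfloor>a / \<tau>\<rfloor>"
  define b where "b = a - of_int k * \<tau>"
  have "of_int k \<le> a / \<tau>" "a / \<tau> < of_int k + 1"
    unfolding k_def by linarith+
  then have b: "0 \<le> b" "b \<le> \<tau>"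
    using \<open>\<tau> > 0\<close> by (auto simp: b_def field_simps)
  have "(\<integral>\<^sup>+x\<in>{a..<a + \<tau>}. f x \<partial>lborel) = (\<integral>\<^sup>+x\<in>{b..<b + \<tau>}. f x \<partial>lborel)"
    using shift[of b k "b + \<tau>"] by (simp add: b_def algebra_simps)
  also have "\<dots> = (\<integral>\<^sup>+x\<in>{b..<\<tau>}. f x \<partial>lborel) + (\<integral>\<^sup>+x\<in>{\<tau>..<b + \<tau>}. f x \<partial>lborel)"
    using b by (intro split) auto
  also have "(\<integral>\<^sup>+x\<in>{\<tau>..<b + \<tau>}. f x \<partial>lborel) = (\<integral>\<^sup>+x\<in>{0..<b}. f x \<partial>lborel)"
    using shift[of 0 1 b] by simp
  also have "(\<integral>\<^sup>+x\<in>{b..<\<tau>}. f x \<partial>lborel) + (\<integral>\<^sup>+x\<in>{0..<b}. f x \<partial>lborel) =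
      (\<integral>\<^sup>+x\<in>{0..<\<tau>}. f x \<partial>lborel)"
    using split[of 0 b \<tau>] b by (simp add: add.commute)
  finally show ?thesis .
qed

section \<open>Freezing one of two independent variables\<close>

text \<open>Independence makes the joint law of \<open>X\<close> and \<open>Z\<close> a product
  measure, so the preimage of \<open>B\<close> under \<open>g\<close> can be measured slice by slice
  with \<open>z\<close> held fixed. The target \<open>N\<close> is arbitrary; below it is \<Omega>
  with the small sigma-algebra \<open>F 0 t\<close>, and \<open>X\<close> is a shift.\<close>

lemma (in prob_space) emeasure_distr_indep_pair:
  assumes "subalgebra M \<A>" "subalgebra M \<B>" and indep: "indep_set (sets \<A>) (sets \<B>)"
    and X\<A>: "X \<in> \<A> \<rightarrow>\<^sub>M N" and Z\<B>: "Z \<in> \<B> \<rightarrow>\<^sub>M T"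
    and g: "(\<lambda>(x, z). g x z) \<in> N \<Otimes>\<^sub>M T \<rightarrow>\<^sub>M R" and B: "B \<in> sets R"
  shows "emeasure (distr M R (\<lambda>\<omega>. g (X \<omega>) (Z \<omega>))) B =
    (\<integral>\<^sup>+z. emeasure (distr M N X) {x \<in> space N. g x z \<in> B} \<partial>distr M T Z)"
proof -
  have X: "X \<in> M \<rightarrow>\<^sub>M N" and Z: "Z \<in> M \<rightarrow>\<^sub>M T"
    using measurable_from_subalg X\<A> Z\<B> assms(1,2) by blast+
  interpret X: prob_space "distr M N X" by (rule prob_space_distr[OF X])
  interpret Z: prob_space "distr M T Z" by (rule prob_space_distr[OF Z])
  interpret XZ: pair_prob_space "distr M N X" "distr M T Z" ..
  \<comment> \<open>It suffices to compare the two measures on rectangles. There the product formula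
    is independence of the two preimages, one in \<open>\<A>\<close> and one in
    \<open>\<B>\<close>.\<close>
  have prod: "distr M N X \<Otimes>\<^sub>M distr M T Z = distr M (N \<Otimes>\<^sub>M T) (\<lambda>\<omega>. (X \<omega>, Z \<omega>))"
  proof (rule pair_measure_eqI)
    show "sigma_finite_measure (distr M N X)" "sigma_finite_measure (distr M T Z)" ..
    show "sets (distr M N X \<Otimes>\<^sub>M distr M T Z) = sets (distr M (N \<Otimes>\<^sub>M T) (\<lambda>\<omega>. (X \<omega>, Z \<omega>)))"
      by (simp cong: sets_pair_measure_cong)
    fix C D assume "C \<in> sets (distr M N X)" "D \<in> sets (distr M T Z)"
    then have CD [measurable]: "C \<in> sets N" "D \<in> sets T" by auto
    have "X -` C \<inter> space M \<in> sets \<A>" "Z -` D \<inter> space M \<in> sets \<B>"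
      using measurable_sets[OF X\<A> CD(1)] measurable_sets[OF Z\<B> CD(2)] assms(1,2)
      by (auto simp: subalgebra_def)
    then have "prob ((X -` C \<inter> space M) \<inter> (Z -` D \<inter> space M)) =
        prob (X -` C \<inter> space M) * prob (Z -` D \<inter> space M)"
      by (rule indep_setD[OF indep])
    moreover have "(\<lambda>\<omega>. (X \<omega>, Z \<omega>)) -` (C \<times> D) \<inter> space M = (X -` C \<inter> space M) \<inter> (Z -` D \<inter> space M)"
      by auto
    ultimately show "emeasure (distr M N X) C * emeasure (distr M T Z) D =
        emeasure (distr M (N \<Otimes>\<^sub>M T) (\<lambda>\<omega>. (X \<omega>, Z \<omega>))) (C \<times> D)"
      using X Z CD by (simp add: emeasure_distr emeasure_eq_measure ennreal_mult)
  qed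
  let ?G = "(\<lambda>(x, z). g x z) -` B \<inter> space (N \<Otimes>\<^sub>M T)"
  have G: "?G \<in> sets (N \<Otimes>\<^sub>M T)"
    using g B by (rule measurable_sets)
  have "distr M R (\<lambda>\<omega>. g (X \<omega>) (Z \<omega>)) =
      distr (distr M (N \<Otimes>\<^sub>M T) (\<lambda>\<omega>. (X \<omega>, Z \<omega>))) R (\<lambda>(x, z). g x z)"
    using X Z by (subst distr_distr[OF g]) (auto simp: o_def)
  then have "emeasure (distr M R (\<lambda>\<omega>. g (X \<omega>) (Z \<omega>))) B = emeasure (distr M N X \<Otimes>\<^sub>M distr M T Z) ?G"
    unfolding prod using g B by (simp add: emeasure_distr)
  also have "\<dots> = (\<integral>\<^sup>+z. emeasure (distr M N X) ((\<lambda>x. (x, z)) -` ?G) \<partial>distr M T Z)"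
    using G by (intro XZ.emeasure_pair_measure_alt2) (simp cong: sets_pair_measure_cong)
  also have "\<dots> = (\<integral>\<^sup>+z. emeasure (distr M N X) {x \<in> space N. g x z \<in> B} \<partial>distr M T Z)"
    by (intro nn_integral_cong arg_cong[where f="emeasure _"]) (auto simp: space_pair_measure)
  finally show ?thesis .
qed

section \<open>The transition kernel and invariance of time averages\<close>

text \<open>At a fixed time the cocycle is jointly measurable in state and sample point, so the
  push-forward of \<open>M\<close> depends measurably on the state. This provides the kernel needed
  for associativity of \<open>bind\<close>.\<close>

lemma measurable_transition_prob:
  assumes "prob_space M" "cocycle M \<theta> \<Phi>" "t \<ge> 0"
  shows "transition_prob M \<Phi> t \<in> borel \<rightarrow>\<^sub>M prob_algebra borel"
proof (rule measurable_prob_algebraI)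
  interpret prob_space M by fact
  have *: "(\<lambda>(t, \<omega>, x). \<Phi> t \<omega> x) \<in> restrict_space borel {0..} \<Otimes>\<^sub>M M \<Otimes>\<^sub>M borel \<rightarrow>\<^sub>M borel"
    using assms by (simp add: cocycle_def)
  have "(\<lambda>p. (t, snd p, fst p)) \<in> borel \<Otimes>\<^sub>M M \<rightarrow>\<^sub>M restrict_space borel {0..} \<Otimes>\<^sub>M M \<Otimes>\<^sub>M borel"
    using assms by (intro measurable_Pair) (auto simp: space_restrict_space)
  from measurable_compose[OF this *]
  have \<Phi>: "(\<lambda>(x, \<omega>). \<Phi> t \<omega> x) \<in> borel \<Otimes>\<^sub>M M \<rightarrow>\<^sub>M borel"
    by (simp add: case_prod_beta)
  moreover have "M \<in> space (subprob_algebra M)"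
    by (simp add: space_subprob_algebra prob_space_imp_subprob_space prob_space_axioms)
  ultimately show "transition_prob M \<Phi> t \<in> borel \<rightarrow>\<^sub>M subprob_algebra borel"
    unfolding transition_prob_def by (intro measurable_distr2[where M=M] measurable_const) auto
  show "prob_space (transition_prob M \<Phi> t x)" for x
    unfolding transition_prob_def using measurable_Pair2[OF \<Phi>, of x] by (intro prob_space_distr) simp
qed

lemma prob_algebra_time_average:
  assumes "\<tau> > 0" "\<rho> \<in> borel \<rightarrow>\<^sub>M prob_algebra borel"
  shows "time_average \<tau> \<rho> \<in> space (prob_algebra borel)"
proof -
  interpret U: prob_space "uniform_measure lborel {0..<\<tau>}"
    using assms(1) by (intro prob_space_uniform_measure) auto
  have \<rho>: "\<rho> \<in> uniform_measure lborel {0..<\<tau>} \<rightarrow>\<^sub>M subprob_algebra borel"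
    using measurable_prob_algebraD[OF assms(2)] by simp
  have "sets (uniform_measure lborel {0..<\<tau>} \<bind> \<rho>) = sets borel"
    using sets_kernel[OF \<rho>] by (intro sets_bind) auto
  moreover
  have "prob_space (\<rho> s)" for s
    using measurable_space[OF assms(2), of s] by (simp add: space_prob_algebra)
  then have "prob_space (uniform_measure lborel {0..<\<tau>} \<bind> \<rho>)"
    using U.prob_space_bind[OF _ \<rho>] by simp
  ultimately show ?thesis
    by (simp add: time_average_def space_prob_algebra)
qed

text \<open>No path is involved: for any measurable periodic measure,
  \<open>dual_semigroup M \<Phi> t\<close> passes under the average by associativity of
  \<open>bind\<close> and turns \<open>\<rho> s\<close> into \<open>\<rho> (t + s)\<close>. This
  only moves the averaging window to \<open>{t..<t + \<tau>}\<close>, which periodicity cannot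
  detect.\<close>

lemma invariant_measure_time_average:
  assumes "prob_space M" "cocycle M \<theta> \<Phi>" "\<tau> > 0" "periodic_measure M \<Phi> \<tau> \<rho>"
    and meas: "\<rho> \<in> borel \<rightarrow>\<^sub>M prob_algebra borel"
  shows "invariant_measure M \<Phi> (time_average \<tau> \<rho>)"
  unfolding invariant_measure_def
proof (intro conjI allI impI)
  show prob: "time_average \<tau> \<rho> \<in> space (prob_algebra borel)"
    using assms(3) meas by (rule prob_algebra_time_average)
  fix t :: real assume t: "t \<ge> 0"
  have per: "\<rho> (s + \<tau>) = \<rho> s" and flow: "\<rho> (t + s) = dual_semigroup M \<Phi> t (\<rho> s)" for s
    using assms(4) t by (auto simp: periodic_measure_def)
  have meas': "(\<lambda>s. \<rho> (t + s)) \<in> borel \<rightarrow>\<^sub>M prob_algebra borel"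
    by (rule measurable_compose[OF _ meas]) simp
  have "dual_semigroup M \<Phi> t (time_average \<tau> \<rho>) = time_average \<tau> (\<lambda>s. \<rho> (t + s))"
    unfolding dual_semigroup_def time_average_def flow
    using measurable_prob_algebraD[OF meas]
      measurable_prob_algebraD[OF measurable_transition_prob[OF assms(1,2) t]]
    by (intro bind_assoc) auto
  also have "\<dots> = time_average \<tau> \<rho>"
  proof (rule measure_eqI)
    show "sets (time_average \<tau> (\<lambda>s. \<rho> (t + s))) = sets (time_average \<tau> \<rho>)"
      using prob prob_algebra_time_average[OF assms(3) meas'] by (simp add: space_prob_algebra)
    fix B assume "B \<in> sets (time_average \<tau> (\<lambda>s. \<rho> (t + s)))"
    then have B [measurable]: "B \<in> sets borel"
      using prob_algebra_time_average[OF assms(3) meas'] by (simp add: space_prob_algebra)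
    have [measurable]: "\<rho> \<in> borel \<rightarrow>\<^sub>M subprob_algebra borel"
      using meas by (rule measurable_prob_algebraD)
    have "(\<integral>\<^sup>+s\<in>{0..<\<tau>}. emeasure (\<rho> (t + s)) B \<partial>lborel) =
        (\<integral>\<^sup>+s\<in>{t..<t + \<tau>}. emeasure (\<rho> s) B \<partial>lborel)"
      \<comment> \<open>The substitution acts on the right-hand integral and carries its window back
        to \<open>{0..<\<tau>}\<close>.\<close>
      by (subst (2) nn_integral_real_affine[where c=1 and t=t])
         (auto intro!: nn_integral_cong split: split_indicator)
    also have "\<dots> = (\<integral>\<^sup>+s\<in>{0..<\<tau>}. emeasure (\<rho> s) B \<partial>lborel)"
      using assms(3) by (intro nn_integral_periodic) (auto simp: per)
    finally show "emeasure (time_average \<tau> (\<lambda>s. \<rho> (t + s))) B = emeasure (time_average \<tau> \<rho>) B"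
      by (simp add: emeasure_time_average[OF assms(3) _ B] meas meas')
  qed
  finally show "dual_semigroup M \<Phi> t (time_average \<tau> \<rho>) = time_average \<tau> \<rho>" .
qed

section \<open>Shifted increments and the evolution of laws\<close>

context filtered_metric_dynamical_system
begin

lemma space_filtration: "s \<le> t \<Longrightarrow> space (F s t) = space M"
  using filtration_subalgebra by (auto simp: subalgebra_def)

lemma subalgebra_past: "subalgebra M (past M F s)"
proof -
  have "(\<Union>r\<in>{..s}. sets (F r s)) \<subseteq> sets M"
    using filtration_subalgebra by (auto simp: subalgebra_def)
  then show ?thesis
    unfolding past_def subalgebra_def
    using sets.sigma_sets_subset sets.space_closed by (auto simp: space_measure_of_conv sets_measure_of_conv)
qed

text \<open>Pulling \<open>F 0 t\<close> back along \<open>\<theta> s\<close> gives exactly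
  \<open>F s (t + s)\<close>. Hence the shifted cocycle depends only on the increment over
  \<open>[s, t + s]\<close>, the one that is independent of the past at \<open>s\<close>.\<close>

lemma shift_measurable_filtration:
  assumes "t \<ge> 0"
  shows "\<theta> s \<in> F s (t + s) \<rightarrow>\<^sub>M F 0 t"
proof (rule measurableI)
  fix \<omega> assume "\<omega> \<in> space (F s (t + s))"
  then show "\<theta> s \<omega> \<in> space (F 0 t)"
    using assms measurable_space[OF shift_measurable] by (simp add: space_filtration)
next
  fix A assume "A \<in> sets (F 0 t)"
  then show "\<theta> s -` A \<inter> space (F s (t + s)) \<in> sets (F s (t + s))"
    using filtration_shift[of 0 t s] assms by (auto simp: space_filtration)
qed

lemma shift_measurable_into_filtration: "t \<ge> 0 \<Longrightarrow> \<theta> s \<in> M \<rightarrow>\<^sub>M F 0 t"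
  by (rule measurable_from_subalg[OF filtration_subalgebra shift_measurable_filtration]) auto

text \<open>The image measure lives on the smaller sigma-algebra \<open>F 0 t\<close>, so
  \<open>shift_preserving\<close> does not apply to it literally; it applies after the event is
  regarded as one of \<open>M\<close>.\<close>

lemma distr_shift_filtration:
  assumes "t \<ge> 0" "A \<in> sets (F 0 t)"
  shows "emeasure (distr M (F 0 t) (\<theta> s)) A = emeasure M A"
proof -
  have A: "A \<in> sets M"
    using filtration_subalgebra[of 0 t] assms by (auto simp: subalgebra_def)
  have "emeasure (distr M (F 0 t) (\<theta> s)) A = emeasure M (\<theta> s -` A \<inter> space M)"
    using shift_measurable_into_filtration assms by (intro emeasure_distr)
  also have "\<dots> = emeasure (distr M M (\<theta> s)) A"
    using shift_measurable A by (simp add: emeasure_distr)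
  finally show ?thesis by (simp add: shift_preserving)
qed

text \<open>The Markov property in integrated form, for any \<open>Z\<close> known at time
  \<open>s\<close>. The shift \<open>\<theta> s\<close> into \<open>F 0 t\<close> is independent of
  \<open>Z\<close>; freezing \<open>Z\<close> at \<open>x\<close> leaves a variable with law
  \<open>transition_prob M \<Phi> t x\<close>, and integrating over the law of \<open>Z\<close>
  gives the dual semigroup.\<close>

lemma law_evolution:
  assumes markov: "markovian_cocycle M \<theta> F \<Phi>" and "t \<ge> 0" and Z: "Z \<in> past M F s \<rightarrow>\<^sub>M borel"
  shows "distr M borel (\<lambda>\<omega>. \<Phi> t (\<theta> s \<omega>) (Z \<omega>)) = dual_semigroup M \<Phi> t (distr M borel Z)"
proof (rule measure_eqI)
  have cocycle: "cocycle M \<theta> \<Phi>" and \<Phi>: "(\<lambda>(\<omega>, x). \<Phi> t \<omega> x) \<in> F 0 t \<Otimes>\<^sub>M borel \<rightarrow>\<^sub>M borel"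
    using markov \<open>t \<ge> 0\<close> by (auto simp: markovian_cocycle_def)
  have indep: "indep_set (sets (F s (t + s))) (sets (past M F s))"
    using markov \<open>t \<ge> 0\<close> by (simp add: markovian_cocycle_def)
  have sub: "subalgebra M (F s (t + s))"
    using \<open>t \<ge> 0\<close> by (intro filtration_subalgebra) simp
  have ZM: "Z \<in> M \<rightarrow>\<^sub>M borel"
    using subalgebra_past Z by (rule measurable_from_subalg)
  then have prob: "distr M borel Z \<in> space (prob_algebra borel)"
    by (simp add: space_prob_algebra prob_space_distr)
  have "sets (dual_semigroup M \<Phi> t (distr M borel Z)) = sets borel"
    unfolding dual_semigroup_def using not_empty by (intro sets_bind) (auto simp: transition_prob_def)
  then show "sets (distr M borel (\<lambda>\<omega>. \<Phi> t (\<theta> s \<omega>) (Z \<omega>))) = sets (dual_semigroup M \<Phi> t (distr M borel Z))"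
    by simp
  fix B assume "B \<in> sets (distr M borel (\<lambda>\<omega>. \<Phi> t (\<theta> s \<omega>) (Z \<omega>)))"
  then have B: "B \<in> sets borel" by simp
  \<comment> \<open>For frozen \<open>x\<close> the event belongs to \<open>F 0 t\<close>, so its
    probability is not changed by the shift.\<close>
  have "emeasure (distr M (F 0 t) (\<theta> s)) {\<omega> \<in> space (F 0 t). \<Phi> t \<omega> x \<in> B} =
      emeasure (transition_prob M \<Phi> t x) B" for x
  proof -
    have "(\<lambda>\<omega>. \<Phi> t \<omega> x) \<in> F 0 t \<rightarrow>\<^sub>M borel"
      using measurable_Pair1[OF \<Phi>, of x] by simp
    then have "{\<omega> \<in> space (F 0 t). \<Phi> t \<omega> x \<in> B} \<in> sets (F 0 t)"
      using B by measurable
    then show ?thesis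
      using \<open>t \<ge> 0\<close> by (simp add: distr_shift_filtration emeasure_transition_prob[OF cocycle _ B] space_filtration)
  qed
  then show "emeasure (distr M borel (\<lambda>\<omega>. \<Phi> t (\<theta> s \<omega>) (Z \<omega>))) B =
      emeasure (dual_semigroup M \<Phi> t (distr M borel Z)) B"
    by (simp add: emeasure_distr_indep_pair[OF sub subalgebra_past indep shift_measurable_filtration[OF \<open>t \<ge> 0\<close>] Z \<Phi> B]
        emeasure_dual_semigroup[OF prob_space_axioms cocycle \<open>t \<ge> 0\<close> prob B])
qed

text \<open>Periodicity in law holds because \<open>Y (s + \<tau>)\<close> is almost surely
  \<open>Y s\<close> composed with the measure-preserving \<open>\<theta> \<tau>\<close>. The
  evolution is \<open>law_evolution\<close> with \<open>Z\<close> taken as \<open>Y s\<close>, which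
  adaptedness permits.\<close>

lemma periodic_measure_law:
  assumes markov: "markovian_cocycle M \<theta> F \<Phi>" and path: "random_periodic_path M \<theta> \<Phi> \<tau> Y"
    and adapted: "adapted M F Y"
  shows "periodic_measure M \<Phi> \<tau> (\<lambda>s. distr M borel (Y s))"
  unfolding periodic_measure_def
proof (intro conjI allI impI)
  have jm: "(\<lambda>(s, \<omega>). Y s \<omega>) \<in> borel \<Otimes>\<^sub>M M \<rightarrow>\<^sub>M borel"
    and ae: "AE \<omega> in M. \<forall>t\<ge>0. \<forall>s. \<Phi> t (\<theta> s \<omega>) (Y s \<omega>) = Y (t + s) \<omega> \<and> Y (s + \<tau>) \<omega> = Y s (\<theta> \<tau> \<omega>)"
    using path by (auto simp: random_periodic_path_def)
  have Y [measurable]: "Y s \<in> M \<rightarrow>\<^sub>M borel" for s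
    using measurable_Pair2[OF jm, of s] by simp
  note shift_measurable [measurable]
  fix s
  show "distr M borel (Y s) \<in> space (prob_algebra borel)"
    by (simp add: space_prob_algebra prob_space_distr)
  have "distr M borel (Y (s + \<tau>)) = distr M borel (\<lambda>\<omega>. Y s (\<theta> \<tau> \<omega>))"
    using ae by (intro distr_cong_AE) auto
  also have "\<dots> = distr (distr M M (\<theta> \<tau>)) borel (Y s)"
    by (subst distr_distr) (auto simp: o_def)
  finally show "distr M borel (Y (s + \<tau>)) = distr M borel (Y s)"
    by (simp add: shift_preserving)
  fix t :: real assume t: "0 \<le> t"
  have \<Phi>: "(\<lambda>(\<omega>, x). \<Phi> t \<omega> x) \<in> F 0 t \<Otimes>\<^sub>M borel \<rightarrow>\<^sub>M borel"
    using markov t by (auto simp: markovian_cocycle_def)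
  have Ys: "Y s \<in> past M F s \<rightarrow>\<^sub>M borel"
    using adapted by (simp add: adapted_def)
  \<comment> \<open>The path equation holds only almost surely, so equality of laws requires both
    variables to be measurable; here \<open>\<theta> s\<close> is paired with \<open>Y s\<close> as
    a map into \<open>F 0 t\<close> times the state space.\<close>
  have "(\<lambda>\<omega>. \<Phi> t (\<theta> s \<omega>) (Y s \<omega>)) \<in> M \<rightarrow>\<^sub>M borel"
    using measurable_compose[OF measurable_Pair[OF shift_measurable_into_filtration[OF t] Y] \<Phi>] by simp
  then have "distr M borel (Y (t + s)) = distr M borel (\<lambda>\<omega>. \<Phi> t (\<theta> s \<omega>) (Y s \<omega>))"
    using ae t by (intro distr_cong_AE) auto
  also have "\<dots> = dual_semigroup M \<Phi> t (distr M borel (Y s))"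
    using markov t Ys by (rule law_evolution)
  finally show "distr M borel (Y (t + s)) = dual_semigroup M \<Phi> t (distr M borel (Y s))" .
qed

end

section \<open>Laws of measurable processes and occupation times\<close>

lemma (in prob_space) measurable_law:
  assumes "(\<lambda>(s, \<omega>). Y s \<omega>) \<in> S \<Otimes>\<^sub>M M \<rightarrow>\<^sub>M T"
  shows "(\<lambda>s. distr M T (Y s)) \<in> S \<rightarrow>\<^sub>M prob_algebra T"
proof (rule measurable_prob_algebraI)
  have "M \<in> space (subprob_algebra M)"
    by (simp add: space_subprob_algebra prob_space_imp_subprob_space prob_space_axioms)
  then show "(\<lambda>s. distr M T (Y s)) \<in> S \<rightarrow>\<^sub>M subprob_algebra T"
    using assms by (intro measurable_distr2[where M=M] measurable_const) auto
  show "prob_space (distr M T (Y s))" if "s \<in> space S" for s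
    using measurable_Pair2[OF assms that] by (intro prob_space_distr) simp
qed

text \<open>The time spent in \<open>B\<close> is the integral over \<open>s\<close> of the
  indicator of \<open>Y s \<omega> \<in> B\<close>; exchanging it with the expectation leaves the
  integral of the probabilities. The exchange takes place in \<open>ennreal\<close>, and boundedness
  by \<open>\<tau>\<close> links it to the real-valued expectation.\<close>

lemma (in prob_space) expectation_occupation_time:
  assumes jm: "(\<lambda>(s, \<omega>). Y s \<omega>) \<in> borel \<Otimes>\<^sub>M M \<rightarrow>\<^sub>M borel" and B [measurable]: "B \<in> sets borel"
    and "\<tau> > 0"
  shows "ennreal (expectation (\<lambda>\<omega>. 1 / \<tau> * measure lborel {s \<in> {t..<t + \<tau>}. Y s \<omega> \<in> B})) =
    (\<integral>\<^sup>+s\<in>{t..<t + \<tau>}. emeasure (distr M borel (Y s)) B \<partial>lborel) / ennreal \<tau>"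
proof -
  interpret M_lborel: pair_sigma_finite M lborel ..
  have [measurable]: "(\<lambda>p. Y (snd p) (fst p)) \<in> M \<Otimes>\<^sub>M lborel \<rightarrow>\<^sub>M borel"
    using measurable_compose[OF measurable_Pair[OF measurable_snd measurable_fst] jm] by simp
  have Y [measurable]: "Y s \<in> M \<rightarrow>\<^sub>M borel" for s
    using measurable_Pair2[OF jm, of s] by simp
  define K where "K \<omega> = {s \<in> {t..<t + \<tau>}. Y s \<omega> \<in> B}" for \<omega>
  have K: "K \<omega> \<in> sets lborel" if "\<omega> \<in> space M" for \<omega>
  proof -
    have "(\<lambda>s. Y s \<omega>) \<in> borel \<rightarrow>\<^sub>M borel"
      using measurable_Pair1[OF jm that] by simp
    then show ?thesis unfolding K_def by measurable
  qed
  \<comment> \<open>The product form shows joint measurability, which is more than measurability of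
    each section \<open>K \<omega>\<close>.\<close>
  have indicator: "(\<lambda>(\<omega>, s). indicator (K \<omega>) s :: ennreal) =
      (\<lambda>(\<omega>, s). indicator {t..<t + \<tau>} s * indicator B (Y s \<omega>))"
    by (auto simp: K_def fun_eq_iff split: split_indicator)
  have ind [measurable]: "(\<lambda>(\<omega>, s). indicator (K \<omega>) s :: ennreal) \<in> borel_measurable (M \<Otimes>\<^sub>M lborel)"
    unfolding indicator by (simp add: case_prod_beta) measurable
  have em: "emeasure lborel (K \<omega>) = (\<integral>\<^sup>+s. indicator (K \<omega>) s \<partial>lborel)" if "\<omega> \<in> space M" for \<omega>
    using K[OF that] by simp
  have [measurable]: "(\<lambda>\<omega>. emeasure lborel (K \<omega>)) \<in> borel_measurable M"
    using lborel.borel_measurable_nn_integral[OF ind] by (simp add: em cong: measurable_cong)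
  \<comment> \<open>The bound excludes infinite measure, where \<open>measure\<close> would take the
    default value 0. It uses only measurability of the enclosing interval, so it holds for every
    \<open>\<omega>\<close>, also outside \<open>space M\<close>.\<close>
  have le: "emeasure lborel (K \<omega>) \<le> ennreal \<tau>" for \<omega>
    using emeasure_mono[of "K \<omega>" "{t..<t + \<tau>}" lborel] \<open>\<tau> > 0\<close> by (simp add: K_def subset_eq)
  have measure: "ennreal (measure lborel (K \<omega>)) = emeasure lborel (K \<omega>)" for \<omega>
    using le[of \<omega>] by (intro emeasure_eq_ennreal_measure[symmetric]) (auto simp: top_unique)
  have "integrable M (\<lambda>\<omega>. 1 / \<tau> * measure lborel (K \<omega>))"
    using le \<open>\<tau> > 0\<close>
    by (intro integrable_const_bound[where B=1] AE_I2)
       (auto simp: measure_def enn2real_leI divide_le_eq)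
  then have "ennreal (expectation (\<lambda>\<omega>. 1 / \<tau> * measure lborel (K \<omega>))) =
      (\<integral>\<^sup>+\<omega>. ennreal (1 / \<tau> * measure lborel (K \<omega>)) \<partial>M)"
    using \<open>\<tau> > 0\<close> by (intro nn_integral_eq_integral[symmetric]) auto
  also have "\<dots> = (\<integral>\<^sup>+\<omega>. emeasure lborel (K \<omega>) / ennreal \<tau> \<partial>M)"
    using \<open>\<tau> > 0\<close> by (simp add: measure[symmetric] divide_ennreal)
  also have "\<dots> = (\<integral>\<^sup>+\<omega>. emeasure lborel (K \<omega>) \<partial>M) / ennreal \<tau>"
    by (rule nn_integral_divide) simp
  also have "(\<integral>\<^sup>+\<omega>. emeasure lborel (K \<omega>) \<partial>M) = (\<integral>\<^sup>+\<omega>. \<integral>\<^sup>+s. indicator (K \<omega>) s \<partial>lborel \<partial>M)"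
    by (intro nn_integral_cong em)
  also have "\<dots> = (\<integral>\<^sup>+s. \<integral>\<^sup>+\<omega>. indicator (K \<omega>) s \<partial>M \<partial>lborel)"
    by (rule M_lborel.Fubini'[OF ind, symmetric])
  also have "\<dots> = (\<integral>\<^sup>+s\<in>{t..<t + \<tau>}. emeasure (distr M borel (Y s)) B \<partial>lborel)"
  proof (intro nn_integral_cong)
    fix s
    have "(\<integral>\<^sup>+\<omega>. indicator (K \<omega>) s \<partial>M) = (\<integral>\<^sup>+\<omega>. indicator B (Y s \<omega>) * indicator {t..<t + \<tau>} s \<partial>M)"
      by (intro nn_integral_cong) (auto simp: K_def split: split_indicator)
    also have "\<dots> = (\<integral>\<^sup>+\<omega>. indicator B (Y s \<omega>) \<partial>M) * indicator {t..<t + \<tau>} s"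
      by (rule nn_integral_multc) simp
    also have "(\<integral>\<^sup>+\<omega>. indicator B (Y s \<omega>) \<partial>M) = (\<integral>\<^sup>+x. indicator B x \<partial>distr M borel (Y s))"
      by (rule nn_integral_distr[symmetric]) auto
    finally show "(\<integral>\<^sup>+\<omega>. indicator (K \<omega>) s \<partial>M) =
        emeasure (distr M borel (Y s)) B * indicator {t..<t + \<tau>} s"
      by simp
  qed
  finally show ?thesis unfolding K_def .
qed

section \<open>The law of the path, its average and the occupation formulas\<close>

theorem theorem3p6:
  fixes M :: "'w measure" and \<theta> :: "real \<Rightarrow> 'w \<Rightarrow> 'w" and F :: "real \<Rightarrow> real \<Rightarrow> 'w measure"
    and \<Phi> :: "real \<Rightarrow> 'w \<Rightarrow> 'x::polish_space \<Rightarrow> 'x" and Y :: "real \<Rightarrow> 'w \<Rightarrow> 'x" and \<tau> :: real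
    and \<rho> :: "real \<Rightarrow> 'x measure" and \<rho>bar :: "'x measure"
  assumes "filtered_metric_dynamical_system M \<theta> F"
    and "markovian_cocycle M \<theta> F \<Phi>"
    and "random_periodic_path M \<theta> \<Phi> \<tau> Y"
    and "adapted M F Y"
    and \<rho>: "\<rho> = (\<lambda>s. expected_measure M (random_dirac \<theta> Y s))"
    and \<rho>bar: "\<rho>bar = time_average \<tau> \<rho>"
  shows "(\<forall>s. \<rho> s = expected_measure M (\<lambda>\<omega>. return borel (Y s \<omega>)) \<and> \<rho> s = distr M borel (Y s)) \<and>
    periodic_measure M \<Phi> \<tau> \<rho> \<and>
    invariant_measure M \<Phi> \<rho>bar \<and>
    (\<forall>B\<in>sets borel. \<forall>t.
       measure \<rho>bar B = prob_space.expectation M (\<lambda>\<omega>. 1 / \<tau> * measure lborel {s \<in> {0..<\<tau>}. Y s \<omega> \<in> B}) \<and>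
       measure \<rho>bar B = prob_space.expectation M (\<lambda>\<omega>. 1 / \<tau> * measure lborel {s \<in> {t..<t + \<tau>}. Y s \<omega> \<in> B}))"
proof -
  interpret filtered_metric_dynamical_system M \<theta> F by fact
  have cocycle: "cocycle M \<theta> \<Phi>"
    using assms(2) by (simp add: markovian_cocycle_def)
  have \<tau>: "\<tau> > 0" and jm: "(\<lambda>(s, \<omega>). Y s \<omega>) \<in> borel \<Otimes>\<^sub>M M \<rightarrow>\<^sub>M borel"
    using assms(3) by (auto simp: random_periodic_path_def)
  have Y: "Y s \<in> M \<rightarrow>\<^sub>M borel" for s
    using measurable_Pair2[OF jm, of s] by simp
  have dirac: "expected_measure M (\<lambda>\<omega>. return borel (Y s \<omega>)) = distr M borel (Y s)" for s
    unfolding expected_measure_def using not_empty Y by (rule bind_return_distr')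
  \<comment> \<open>Averaging Dirac masses gives the law of \<open>Y s\<close> composed with
    \<open>\<theta> (- s)\<close>, and this shift preserves \<open>M\<close>.\<close>
  have law: "\<rho> s = distr M borel (Y s)" for s
  proof -
    have "\<rho> s = distr M borel (\<lambda>\<omega>. Y s (\<theta> (- s) \<omega>))"
      unfolding \<rho> expected_measure_def random_dirac_def
      using measurable_compose[OF shift_measurable Y] by (rule bind_return_distr'[OF not_empty])
    also have "\<dots> = distr (distr M M (\<theta> (- s))) borel (Y s)"
      by (subst distr_distr[OF Y shift_measurable]) (simp add: o_def)
    finally show ?thesis by (simp add: shift_preserving)
  qed
  then have \<rho>_eq: "\<rho> = (\<lambda>s. distr M borel (Y s))" by auto
  have periodic: "periodic_measure M \<Phi> \<tau> \<rho>"
    unfolding \<rho>_eq using assms(2-4) by (rule periodic_measure_law)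
  have meas: "\<rho> \<in> borel \<rightarrow>\<^sub>M prob_algebra borel"
    unfolding \<rho>_eq using jm by (rule measurable_law)
  have inv: "invariant_measure M \<Phi> \<rho>bar"
    unfolding \<rho>bar using prob_space_axioms cocycle \<tau> periodic meas
    by (rule invariant_measure_time_average)
  then interpret \<rho>bar: prob_space \<rho>bar
    by (simp add: invariant_measure_def space_prob_algebra)
  \<comment> \<open>Proved for every starting time \<open>t\<close>; the case \<open>t = 0\<close>
    is the formula over the first period.\<close>
  have occupation: "measure \<rho>bar B =
      expectation (\<lambda>\<omega>. 1 / \<tau> * measure lborel {s \<in> {t..<t + \<tau>}. Y s \<omega> \<in> B})"
    if B [measurable]: "B \<in> sets borel" for B t
  proof -
    have [measurable]: "\<rho> \<in> borel \<rightarrow>\<^sub>M subprob_algebra borel"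
      using meas by (rule measurable_prob_algebraD)
    have per: "\<rho> (s + \<tau>) = \<rho> s" for s
      using periodic by (simp add: periodic_measure_def)
    have "ennreal (measure \<rho>bar B) = (\<integral>\<^sup>+s\<in>{0..<\<tau>}. emeasure (\<rho> s) B \<partial>lborel) / ennreal \<tau>"
      using emeasure_time_average[OF \<tau> meas B] by (simp add: \<rho>bar.emeasure_eq_measure flip: \<rho>bar)
    also have "\<dots> = (\<integral>\<^sup>+s\<in>{t..<t + \<tau>}. emeasure (\<rho> s) B \<partial>lborel) / ennreal \<tau>"
      using \<tau> by (subst nn_integral_periodic) (auto simp: per)
    also have "\<dots> = ennreal (expectation (\<lambda>\<omega>. 1 / \<tau> * measure lborel {s \<in> {t..<t + \<tau>}. Y s \<omega> \<in> B}))"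
      unfolding law by (rule expectation_occupation_time[OF jm B \<tau>, symmetric])
    \<comment> \<open>Both sides are nonnegative reals, and on those \<open>ennreal\<close> is
      injective.\<close>
    finally show ?thesis
      using \<tau> by (subst (asm) ennreal_inj) (auto intro!: integral_nonneg_AE)
  qed
  show ?thesis
    using law dirac periodic inv occupation occupation[of _ 0] by auto
qed

end
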